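(* Let $\Gamma\subseteq\mathbb{R}^s$ be an open convex set, $X\subseteq\Gamma$ a convex set (not necessarily open), $f:\Gamma\to\mathbb{R}$ and $g=(g_1,\dots,g_m):\Gamma\to\mathbb{R}^m$. Consider the problem (P): minimize $f(x)$ subject to $x\in X$, $g_i(x)\leq0$, $i=1,\dots,m$, and let $\bar S$ be its solution set. Let $f$ be continuously differentiable and second-order pseudoconvex, and let $g$ be differentiable and quasiconvex (componentwise). Let $\bar x\in\bar S$ be a known solution of (P), and let the generalized Mangasarian-Fromovitz constraint qualification (GMFCQ) be satisfied at $\bar x$. Suppose that $\mu\in\mathbb{R}^m_+$ is a known Lagrange multiplier which fulfills the KKT conditions at $\bar x$. Then $$\bar S=S_1=S_2=S_3=S_4=S_5,$$ where the sets $S_1,\dots,S_5$ are defined by $$S_1=\{x\in X_1(\mu)\mid \langle\nabla f(\bar x),x-\bar x\rangle=0,\ \exists p(x)>0:\nabla f(x)=p(x)\nabla f(\bar x),\ \exists f''(x,\bar x-x),\ f''(x,\bar x-x)=0\},$$ $$S_2=\{x\in X_1(\mu)\mid \langle\nabla f(\bar x),x-\bar x\rangle\leq0,\ \exists p(x)>0:\nabla f(x)=p(x)\nabla f(\bar x),\ \exists f''(x,\bar x-x),\ f''(x,\bar x-x)\geq0\},$$ $$S_3=\{x\in X_1(\mu)\mid \langle\nabla f(\bar x),x-\bar x\rangle=0,\ \exists p(x)>0:\nabla f(x)=p(x)\nabla f(\bar x),\ \exists f''(x,\bar x-x),\ f''(x,\bar x-x)=f''_-(\bar x,x-\bar x)\},$$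 $$S_4=\{x\in X_1(\mu)\mid \langle\nabla f(\bar x),x-\bar x\rangle\leq0,\ \exists p(x)>0:\nabla f(x)=p(x)\nabla f(\bar x),\ \exists f''(x,\bar x-x),\ f''(x,\bar x-x)\geq f''_-(\bar x,x-\bar x)\},$$ $$S_5=\{x\in X_1(\mu)\mid \langle\nabla f(\bar x),x-\bar x\rangle=0,\ \exists p(x)>0:\nabla f(x)=p(x)\nabla f(\bar x),\ \exists f''(x,\bar x-x),\ f''(x,\bar x-x)=f''_-(\bar x,x-\bar x)=0\}.$$
   Context: $\mathbb{R}^m_+$ is the set of vectors with non-negative components. The solution set $\bar S$ is the set of global minimizers of $f$ over the feasible set $S=\{x\in X\mid g_i(x)\leq0,\ i=1,\dots,m\}$. Active set: $A(\bar x)=\{i\in\{1,\dots,m\}\mid g_i(\bar x)=0\}$. Second-order directional derivative: for $f$ differentiable at $x\in\Gamma$ and $u\in\mathbb{R}^s$, $$f''(x,u)=\lim_{t\to+0}2t^{-2}[f(x+tu)-f(x)-t\langle\nabla f(x),u\rangle]\in\overline{\mathbb{R}}=\mathbb{R}\cup\{\pm\infty\}.$$ The notation $\exists f''(x,u)$ means that this limit exists in $\overline{\mathbb{R}}$; its existence is not assumed in general. The second-order lower Dini directional derivative is $$f''_-(x,u)=\liminf_{t\to0^+}2t^{-2}[f(x+tu)-f(x)-t\langle\nabla f(x),u\rangle]\in\overline{\mathbb{R}}.$$ A scalar function $h:\Gamma\to\mathbb{R}$ on a convex set $\Gamma$ is quasiconvex iff $x,y\in\Gamma$, $h(y)\leq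 h(x)$, $t\in[0,1]$ imply $h((1-t)x+ty)\leq h(x)$. A scalar function $h:\Gamma\to\mathbb{R}$ that is differentiable on the open set $\Gamma$, and second-order directionally differentiable (i.e. $h''(x,y-x)$ exists in $\overline{\mathbb{R}}$) at every $x\in\Gamma$ in each direction $y-x$ such that $y\in\Gamma$, $h(y)<h(x)$, $\langle\nabla h(x),y-x\rangle=0$, is second-order pseudoconvex (on $\Gamma$) iff for all $x,y\in\Gamma$: (i) $h(y)<h(x)$ implies $\langle\nabla h(x),y-x\rangle\leq0$; (ii) $h(y)<h(x)$ and $\langle\nabla h(x),y-x\rangle=0$ imply $h''(x,y-x)<0$. For a cone $C\subseteq\mathbb{R}^s$, its negative polar cone is $C^*=\{c\in\mathbb{R}^s\mid\langle c,x\rangle\leq0\text{ for all }x\in C\}$. $T_X(x)$ is the tangent cone of $X$ at $x$, and the normal cone is $N_X(x)=(T_X(x))^*$. GMFCQ holds at $\bar x$ iff there is a direction $y\in(N_X(\bar x))^*$ such that $\langle\nabla g_i(\bar x),y\rangle<0$ for all $i\in A(\bar x)$. KKT conditions at $\bar x$ with multiplier $\mu=(\mu_1,\dots,\mu_m)$, $\mu_i\geq0$: $$\Big\langle\nabla f(\bar x)+\sum_{i\in A(\bar x)}\mu_i\nabla g_i(\bar x),\,x-\bar x\Big\rangle\geq0\ \text{ for all }x\in X,\qquad \mu_ig_i(\bar x)=0,\ i=1,\dots,m.$$ Index set $\tilde A(\bar x,\mu)=\{i\in\{1,\dots,m\}\mid g_i(\bar x)=0,\ \mu_i>0\}$ and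 $$X_1(\mu)=\{x\in X\mid g_i(x)=0\ \forall i\in\tilde A(\bar x,\mu),\ \ g_i(x)\leq0\ \forall i\in\{1,\dots,m\}\setminus\tilde A(\bar x,\mu)\}.$$ *)

theory Defs
  imports "HOL-Analysis.Analysis"
begin

text \<open>Functions on \<open>\<Gamma>\<close> are represented by total functions of which only the values on the open
  set \<open>\<Gamma>\<close> matter.\<close>

definition gradient :: "('a::real_inner \<Rightarrow> real) \<Rightarrow> 'a \<Rightarrow> 'a" where
  "gradient f x = (THE D. GDERIV f x :> D)"

definition continuously_differentiable_on :: "'a::real_inner set \<Rightarrow> ('a \<Rightarrow> real) \<Rightarrow> bool" where
  "continuously_differentiable_on \<Gamma> f \<longleftrightarrow>
     (\<forall>x\<in>\<Gamma>. f differentiable (at x)) \<and> continuous_on \<Gamma> (gradient f)"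

definition second_quot :: "('a::real_inner \<Rightarrow> real) \<Rightarrow> 'a \<Rightarrow> 'a \<Rightarrow> real \<Rightarrow> ereal" where
  "second_quot f x u t =
     ereal (2 / t\<^sup>2 * (f (x + t *\<^sub>R u) - f x - t * (gradient f x \<bullet> u)))"

definition second_deriv_exists :: "('a::real_inner \<Rightarrow> real) \<Rightarrow> 'a \<Rightarrow> 'a \<Rightarrow> bool" where
  "second_deriv_exists f x u \<longleftrightarrow> (\<exists>l::ereal. (second_quot f x u \<longlongrightarrow> l) (at_right 0))"

text \<open>The value is only meaningful together with \<^const>\<open>second_deriv_exists\<close>.\<close>

definition second_deriv :: "('a::real_inner \<Rightarrow> real) \<Rightarrow> 'a \<Rightarrow> 'a \<Rightarrow> ereal" where
  "second_deriv f x u = Lim (at_right 0) (second_quot f x u)"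

definition second_lower_dini :: "('a::real_inner \<Rightarrow> real) \<Rightarrow> 'a \<Rightarrow> 'a \<Rightarrow> ereal" where
  "second_lower_dini f x u = Liminf (at_right 0) (second_quot f x u)"

definition quasiconvex_on :: "'a::real_vector set \<Rightarrow> ('a \<Rightarrow> real) \<Rightarrow> bool" where
  "quasiconvex_on \<Gamma> h \<longleftrightarrow>
     (\<forall>x\<in>\<Gamma>. \<forall>y\<in>\<Gamma>. \<forall>t\<in>{0..1}. h y \<le> h x \<longrightarrow> h ((1 - t) *\<^sub>R x + t *\<^sub>R y) \<le> h x)"

definition second_order_pseudoconvex_on :: "'a::real_inner set \<Rightarrow> ('a \<Rightarrow> real) \<Rightarrow> bool" where
  "second_order_pseudoconvex_on \<Gamma> h \<longleftrightarrow>
     (\<forall>x\<in>\<Gamma>. h differentiable (at x)) \<and>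
     (\<forall>x\<in>\<Gamma>. \<forall>y\<in>\<Gamma>. h y < h x \<and> gradient h x \<bullet> (y - x) = 0 \<longrightarrow> second_deriv_exists h x (y - x)) \<and>
     (\<forall>x\<in>\<Gamma>. \<forall>y\<in>\<Gamma>. h y < h x \<longrightarrow> gradient h x \<bullet> (y - x) \<le> 0) \<and>
     (\<forall>x\<in>\<Gamma>. \<forall>y\<in>\<Gamma>. h y < h x \<and> gradient h x \<bullet> (y - x) = 0 \<longrightarrow> second_deriv h x (y - x) < 0)"

definition neg_polar :: "'a::real_inner set \<Rightarrow> 'a set" where
  "neg_polar C = {c. \<forall>x\<in>C. c \<bullet> x \<le> 0}"

text \<open>Bouligand (contingent) cone; for convex sets it agrees with the other usual tangent cones.\<close>

definition tangent_cone :: "'a::real_normed_vector set \<Rightarrow> 'a \<Rightarrow> 'a set" where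
  "tangent_cone X x =
     {d. \<exists>(z :: nat \<Rightarrow> 'a) (t :: nat \<Rightarrow> real). (\<forall>k. z k \<in> X) \<and> (\<forall>k. 0 < t k) \<and>
         z \<longlonglongrightarrow> x \<and> t \<longlonglongrightarrow> 0 \<and> (\<lambda>k. (z k - x) /\<^sub>R t k) \<longlonglongrightarrow> d}"

definition normal_cone :: "'a::real_inner set \<Rightarrow> 'a \<Rightarrow> 'a set" where
  "normal_cone X x = neg_polar (tangent_cone X x)"

definition feasible_set :: "'a set \<Rightarrow> ('a \<Rightarrow> real^'m) \<Rightarrow> 'a set" where
  "feasible_set X g = {x \<in> X. \<forall>i. g x $ i \<le> 0}"

definition solution_set :: "('a \<Rightarrow> real) \<Rightarrow> 'a set \<Rightarrow> ('a \<Rightarrow> real^'m) \<Rightarrow> 'a set" where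
  "solution_set f X g = {x \<in> feasible_set X g. \<forall>y\<in>feasible_set X g. f x \<le> f y}"

definition active_set :: "('a \<Rightarrow> real^'m) \<Rightarrow> 'a \<Rightarrow> 'm set" where
  "active_set g xb = {i. g xb $ i = 0}"

definition GMFCQ :: "'a::real_inner set \<Rightarrow> ('a \<Rightarrow> real^'m) \<Rightarrow> 'a \<Rightarrow> bool" where
  "GMFCQ X g xb \<longleftrightarrow>
     (\<exists>y\<in>neg_polar (normal_cone X xb).
        \<forall>i\<in>active_set g xb. gradient (\<lambda>z. g z $ i) xb \<bullet> y < 0)"

definition KKT :: "('a::real_inner \<Rightarrow> real) \<Rightarrow> 'a set \<Rightarrow> ('a \<Rightarrow> real^'m) \<Rightarrow> 'a \<Rightarrow> real^'m \<Rightarrow> bool" where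
  "KKT f X g xb \<mu> \<longleftrightarrow>
     (\<forall>i. 0 \<le> \<mu> $ i) \<and>
     (\<forall>x\<in>X. 0 \<le> (gradient f xb +
        (\<Sum>i\<in>active_set g xb. \<mu> $ i *\<^sub>R gradient (\<lambda>z. g z $ i) xb)) \<bullet> (x - xb)) \<and>
     (\<forall>i. \<mu> $ i * g xb $ i = 0)"

definition strict_active_set :: "('a \<Rightarrow> real^'m) \<Rightarrow> 'a \<Rightarrow> real^'m \<Rightarrow> 'm set" where
  "strict_active_set g xb \<mu> = {i. g xb $ i = 0 \<and> 0 < \<mu> $ i}"

definition X1 :: "'a set \<Rightarrow> ('a \<Rightarrow> real^'m) \<Rightarrow> 'a \<Rightarrow> real^'m \<Rightarrow> 'a set" where
  "X1 X g xb \<mu> = {x \<in> X. (\<forall>i\<in>strict_active_set g xb \<mu>. g x $ i = 0) \<and>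
                          (\<forall>i\<in>UNIV - strict_active_set g xb \<mu>. g x $ i \<le> 0)}"

definition S1 where
  "S1 f X (g :: 'a::real_inner \<Rightarrow> real^'m) xb \<mu> =
     {x \<in> X1 X g xb \<mu>. gradient f xb \<bullet> (x - xb) = 0 \<and>
        (\<exists>p>0. gradient f x = p *\<^sub>R gradient f xb) \<and>
        second_deriv_exists f x (xb - x) \<and> second_deriv f x (xb - x) = 0}"

definition S2 where
  "S2 f X (g :: 'a::real_inner \<Rightarrow> real^'m) xb \<mu> =
     {x \<in> X1 X g xb \<mu>. gradient f xb \<bullet> (x - xb) \<le> 0 \<and>
        (\<exists>p>0. gradient f x = p *\<^sub>R gradient f xb) \<and>
        second_deriv_exists f x (xb - x) \<and> second_deriv f x (xb - x) \<ge> 0}"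

definition S3 where
  "S3 f X (g :: 'a::real_inner \<Rightarrow> real^'m) xb \<mu> =
     {x \<in> X1 X g xb \<mu>. gradient f xb \<bullet> (x - xb) = 0 \<and>
        (\<exists>p>0. gradient f x = p *\<^sub>R gradient f xb) \<and>
        second_deriv_exists f x (xb - x) \<and>
        second_deriv f x (xb - x) = second_lower_dini f xb (x - xb)}"

definition S4 where
  "S4 f X (g :: 'a::real_inner \<Rightarrow> real^'m) xb \<mu> =
     {x \<in> X1 X g xb \<mu>. gradient f xb \<bullet> (x - xb) \<le> 0 \<and>
        (\<exists>p>0. gradient f x = p *\<^sub>R gradient f xb) \<and>
        second_deriv_exists f x (xb - x) \<and>
        second_deriv f x (xb - x) \<ge> second_lower_dini f xb (x - xb)}"

definition S5 where
  "S5 f X (g :: 'a::real_inner \<Rightarrow> real^'m) xb \<mu> =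
     {x \<in> X1 X g xb \<mu>. gradient f xb \<bullet> (x - xb) = 0 \<and>
        (\<exists>p>0. gradient f x = p *\<^sub>R gradient f xb) \<and>
        second_deriv_exists f x (xb - x) \<and>
        second_deriv f x (xb - x) = second_lower_dini f xb (x - xb) \<and>
        second_lower_dini f xb (x - xb) = 0}"

end

theory Submission
  imports Defs
begin

text \<open>
  Two observations about a quasiconvex function carry the characterization.

  First, if a quasiconvex \<open>C\<^sup>1\<close> function \<open>f\<close> is constant on a segment, its gradients at the end points
  are positive multiples of each other. Indeed, if \<open>d\<close> is not an ascent direction at one end point
  \<open>x\<close>, then shifting \<open>x\<close> by \<open>s d\<close> while fixing the other end point \<open>y\<close> shifts each intermediate
  point \<open>z\<close> by a fixed fraction of \<open>s d\<close>, and quasiconvexity transfers the bound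
  \<open>f (x + s d) \<le> f x + o(s)\<close> to \<open>z\<close>. Letting \<open>z\<close> tend to \<open>y\<close>, continuity of the gradient gives that
  \<open>d\<close> is not an ascent direction at \<open>y\<close> either
  (\<open>gradient_halfspace_transfer\<close>). Both gradients thus have the same polar half-space. This
  argument also covers vanishing gradients: if one of the two is zero, so is the other.

  Second, a quasiconvex function \<open>h\<close> with \<open>h x < h a\<close> and \<open>\<langle>\<nabla>h a, x - a\<rangle> = 0\<close> has \<open>\<nabla>h a = 0\<close>,
  because \<open>x\<close> may be perturbed in the direction \<open>\<nabla>h a\<close> (\<open>gradient_zero_of_lower_orthogonal\<close>).

  A second-order pseudoconvex function is quasiconvex, so the solution set is convex and \<open>f\<close> is
  constant on every segment between two solutions. Along such a segment all first- and second-order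
  directional derivatives of \<open>f\<close> vanish, and the first observation gives the proportional gradients.
  The KKT inequality then forces \<open>\<langle>\<nabla>g\<^sub>i(xb), x - xb\<rangle> = 0\<close> for every strictly active \<open>i\<close>; since
  GMFCQ excludes \<open>\<nabla>g\<^sub>i(xb) = 0\<close>, the second observation gives \<open>g\<^sub>i(x) = 0\<close>. Hence every
  solution lies in \<open>S5\<close>, which is contained in the other four sets.

  Conversely, if a feasible \<open>x\<close> with positively proportional gradient and \<open>\<langle>\<nabla>f xb, x - xb\<rangle> \<le> 0\<close> is not a
  solution, then \<open>f xb < f x\<close>, and second-order pseudoconvexity at \<open>x\<close> yields orthogonality and
  \<open>f''(x, xb - x) < 0\<close>. This contradicts membership in \<open>S2\<close>, and also membership in \<open>S4\<close>, as
  optimality of \<open>xb\<close> makes the lower Dini derivative at \<open>xb\<close> nonnegative along orthogonal feasible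
  directions. Each of the other three sets is
  contained in \<open>S2\<close> or \<open>S4\<close>.
\<close>

section \<open>Gradients and directional derivatives\<close>

lemma GDERIV_gradient:
  fixes f :: "'a::euclidean_space \<Rightarrow> real"
  assumes "f differentiable (at x)"
  shows "GDERIV f x :> gradient f x"
proof -
  obtain f' where f': "(f has_derivative f') (at x)"
    using assms by (auto simp: differentiable_def)
  then have lin: "linear f'"
    by (rule has_derivative_linear)
  have "f' h = h \<bullet> (\<Sum>b\<in>Basis. f' b *\<^sub>R b)" for h
  proof -
    have "f' h = f' (\<Sum>b\<in>Basis. (h \<bullet> b) *\<^sub>R b)"
      by (simp add: euclidean_representation)
    also have "\<dots> = (\<Sum>b\<in>Basis. (h \<bullet> b) * f' b)"
      using lin by (simp add: linear_sum linear_scale)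
    finally show ?thesis
      by (simp add: inner_sum_right mult.commute)
  qed
  then have ex: "GDERIV f x :> (\<Sum>b\<in>Basis. f' b *\<^sub>R b)"
    unfolding gderiv_def by (intro has_derivative_eq_rhs[OF f'] ext)
  have unique: "D = E" if "GDERIV f x :> D" "GDERIV f x :> E" for D E
  proof -
    have "(\<lambda>h. h \<bullet> D) = (\<lambda>h. h \<bullet> E)"
      using that unfolding gderiv_def by (rule has_derivative_unique)
    then have "(D - E) \<bullet> D = (D - E) \<bullet> E"
      by (rule fun_cong)
    then have "(D - E) \<bullet> (D - E) = 0"
      by (simp add: inner_diff_right)
    then show ?thesis
      by simp
  qed
  show ?thesis
    unfolding gradient_def using ex unique[OF _ ex] by (rule theI)
qed

lemma has_real_derivative_along_line:
  fixes f :: "'a::euclidean_space \<Rightarrow> real"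
  assumes "f differentiable (at (x + t *\<^sub>R d))"
  shows "((\<lambda>s. f (x + s *\<^sub>R d)) has_real_derivative gradient f (x + t *\<^sub>R d) \<bullet> d) (at t)"
proof -
  have "(f has_derivative (\<lambda>h. h \<bullet> gradient f (x + t *\<^sub>R d))) (at (x + t *\<^sub>R d))"
    using GDERIV_gradient[OF assms] by (simp add: gderiv_def)
  moreover have "((\<lambda>s. x + s *\<^sub>R d) has_derivative (\<lambda>s. s *\<^sub>R d)) (at t)"
    by (auto intro!: derivative_eq_intros)
  ultimately have "((\<lambda>s. f (x + s *\<^sub>R d)) has_derivative
      (\<lambda>s. (s *\<^sub>R d) \<bullet> gradient f (x + t *\<^sub>R d))) (at t)"
    by (rule has_derivative_compose[rotated])
  then show ?thesis
    by (simp add: has_field_derivative_def inner_commute mult_commute_abs)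
qed

lemma directional_quotient_tendsto:
  fixes f :: "'a::euclidean_space \<Rightarrow> real"
  assumes "f differentiable (at x)"
  shows "((\<lambda>s. (f (x + s *\<^sub>R d) - f x) / s) \<longlongrightarrow> gradient f x \<bullet> d) (at_right 0)"
proof -
  have "((\<lambda>s. (f (x + s *\<^sub>R d) - f x) / s) \<longlongrightarrow> gradient f x \<bullet> d) (at 0)"
    using has_real_derivative_along_line[of f x 0 d] assms by (simp add: DERIV_def)
  then show ?thesis
    by (rule tendsto_within_subset) simp
qed

lemma eventually_line_in_open:
  fixes x d :: "'a::real_normed_vector"
  assumes "open G" "x \<in> G"
  shows "eventually (\<lambda>s. x + s *\<^sub>R d \<in> G) (at_right 0)"
proof -
  have "((\<lambda>s. x + s *\<^sub>R d) \<longlongrightarrow> x + 0 *\<^sub>R d) (at_right 0)"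
    by (intro tendsto_intros)
  then show ?thesis
    using topological_tendstoD[of _ x "at_right 0" G] assms by simp
qed

lemma eventually_at_right_0_less_1: "eventually (\<lambda>t::real. 0 < t \<and> t < 1) (at_right 0)"
  by (rule eventually_at_rightI[of 0 1]) auto

section \<open>Quasiconvex functions\<close>

lemma quasiconvex_onD:
  assumes "quasiconvex_on G h" "x \<in> G" "y \<in> G" "0 \<le> t" "t \<le> 1" "h y \<le> h x"
  shows "h (x + t *\<^sub>R (y - x)) \<le> h x"
proof -
  have "h ((1 - t) *\<^sub>R x + t *\<^sub>R y) \<le> h x"
    using assms unfolding quasiconvex_on_def by auto
  then show ?thesis
    by (simp add: algebra_simps)
qed

lemma quasiconvex_on_le_max:
  assumes "quasiconvex_on G h" "x \<in> G" "y \<in> G" "0 \<le> t" "t \<le> 1"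
  shows "h (x + t *\<^sub>R (y - x)) \<le> max (h x) (h y)"
proof (cases "h y \<le> h x")
  case True
  then show ?thesis
    using quasiconvex_onD[OF assms] by simp
next
  case False
  have "h (y + (1 - t) *\<^sub>R (x - y)) \<le> h y"
    using False assms by (intro quasiconvex_onD[of G]) auto
  moreover have "y + (1 - t) *\<^sub>R (x - y) = x + t *\<^sub>R (y - x)"
    by (simp add: algebra_simps)
  ultimately show ?thesis
    by simp
qed

lemma gradient_inner_nonpos_of_quasiconvex:
  fixes h :: "'a::euclidean_space \<Rightarrow> real"
  assumes qc: "quasiconvex_on G h" and xy: "x \<in> G" "y \<in> G"
    and diff: "h differentiable (at x)" and le: "h y \<le> h x"
  shows "gradient h x \<bullet> (y - x) \<le> 0"
proof (rule tendsto_upperbound)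
  show "((\<lambda>s. (h (x + s *\<^sub>R (y - x)) - h x) / s) \<longlongrightarrow> gradient h x \<bullet> (y - x)) (at_right 0)"
    by (rule directional_quotient_tendsto[OF diff])
  show "eventually (\<lambda>s. (h (x + s *\<^sub>R (y - x)) - h x) / s \<le> 0) (at_right 0)"
    using eventually_at_right_0_less_1
  proof eventually_elim
    case (elim s)
    then show ?case
      using quasiconvex_onD[OF qc xy, of s] le by (simp add: divide_le_0_iff)
  qed
qed simp

text \<open>The first-order inequality holds not only for \<open>x\<close> but for all points near \<open>x\<close>, in particular for
  those displaced from \<open>x\<close> in the direction of the gradient itself.\<close>

lemma gradient_zero_of_lower_orthogonal:
  fixes h :: "'a::euclidean_space \<Rightarrow> real"
  assumes qc: "quasiconvex_on G h" and G: "open G" "a \<in> G" "x \<in> G"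
    and diff: "h differentiable (at a)" "h differentiable (at x)"
    and less: "h x < h a" and orth: "gradient h a \<bullet> (x - a) = 0"
  shows "gradient h a = 0"
proof -
  define v where "v = gradient h a"
  have "isCont h x"
    using diff(2) by (rule differentiable_imp_continuous_within)
  moreover have "((\<lambda>s. x + s *\<^sub>R v) \<longlongrightarrow> x + 0 *\<^sub>R v) (at_right 0)"
    by (intro tendsto_intros)
  ultimately have "((\<lambda>s. h (x + s *\<^sub>R v)) \<longlongrightarrow> h x) (at_right 0)"
    using isCont_tendsto_compose by fastforce
  then have "eventually (\<lambda>s. h (x + s *\<^sub>R v) < h a) (at_right 0)"
    using less by (rule order_tendstoD(2))
  then have "eventually (\<lambda>s. h (x + s *\<^sub>R v) < h a \<and> x + s *\<^sub>R v \<in> G \<and> 0 < s \<and> s < 1) (at_right 0)"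
    by (intro eventually_conj eventually_line_in_open[OF G(1,3)] eventually_at_right_0_less_1)
  then obtain s where s: "h (x + s *\<^sub>R v) < h a" "x + s *\<^sub>R v \<in> G" "0 < s"
    using eventually_happens'[OF trivial_limit_at_right_real] by blast
  have "v \<bullet> (x + s *\<^sub>R v - a) \<le> 0"
    unfolding v_def
    using gradient_inner_nonpos_of_quasiconvex[OF qc G(2) s(2) diff(1)] s(1) by (simp add: v_def)
  moreover have "v \<bullet> (x + s *\<^sub>R v - a) = v \<bullet> (x - a) + s * (v \<bullet> v)"
    by (simp add: inner_diff_right inner_add_right)
  ultimately have "s * (v \<bullet> v) \<le> 0"
    using orth by (simp add: v_def)
  then show ?thesis
    using s(3) by (auto simp: mult_le_0_iff v_def dest: order.antisym[OF _ inner_ge_zero])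
qed

text \<open>If \<open>f\<close> exceeded \<open>f x\<close> somewhere between \<open>x\<close> and \<open>y\<close>, then just after the last earlier point
  at which \<open>f\<close> is at most \<open>f x\<close> there would be a point with value above \<open>f y\<close> from which
  \<open>f\<close> strictly increases towards \<open>y\<close>.\<close>

lemma quasiconvex_on_of_gradient_condition:
  fixes f :: "'a::euclidean_space \<Rightarrow> real"
  assumes "convex G" and diff: "\<forall>x\<in>G. f differentiable (at x)"
    and grad: "\<forall>x\<in>G. \<forall>y\<in>G. f y < f x \<longrightarrow> gradient f x \<bullet> (y - x) \<le> 0"
  shows "quasiconvex_on G f"
  unfolding quasiconvex_on_def
proof (intro ballI impI)
  fix x y and t :: real
  assume xy: "x \<in> G" "y \<in> G" and t: "t \<in> {0..1}" and le: "f y \<le> f x"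
  define \<phi> where "\<phi> s = f (x + s *\<^sub>R (y - x))" for s
  have inG: "x + s *\<^sub>R (y - x) \<in> G" if "s \<in> {0..1}" for s
  proof -
    have "(1 - s) *\<^sub>R x + s *\<^sub>R y \<in> G"
      using that xy \<open>convex G\<close> by (intro convexD) auto
    then show ?thesis
      by (simp add: algebra_simps)
  qed
  have der: "(\<phi> has_real_derivative gradient f (x + s *\<^sub>R (y - x)) \<bullet> (y - x)) (at s)"
    if "s \<in> {0..1}" for s
    unfolding \<phi>_def using inG[OF that] diff by (intro has_real_derivative_along_line) auto
  have "\<phi> t \<le> f x"
  proof (rule ccontr)
    assume above: "\<not> \<phi> t \<le> f x"
    define T where "T = {s \<in> {0..t}. \<phi> s \<le> f x}"
    have cont: "continuous_on {0..t} \<phi>"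
      using t by (intro DERIV_continuous_on) (auto intro!: DERIV_subset[OF der])
    have "closed ({0..t} \<inter> \<phi> -` {..f x})"
      using cont by (rule continuous_closed_preimage) auto
    then have "closed T"
      by (simp add: T_def vimage_def Int_def)
    moreover have "bounded T"
      unfolding T_def by (rule bounded_subset[of "{0..t}"]) auto
    moreover have "0 \<in> T"
      using t by (simp add: T_def \<phi>_def)
    ultimately obtain a where a: "a \<in> T" "\<And>s. s \<in> T \<Longrightarrow> s \<le> a"
      using compact_attains_sup[of T] by (auto simp: compact_eq_bounded_closed)
    have "a < t"
      using a(1) above by (cases "a = t") (auto simp: T_def)
    have der': "(\<phi> has_real_derivative gradient f (x + s *\<^sub>R (y - x)) \<bullet> (y - x)) (at s)"
      if "a \<le> s" "s \<le> t" for s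
      using that a(1) t by (intro der) (auto simp: T_def)
    obtain c where c: "a < c" "c < t"
      and mvt: "\<phi> t - \<phi> a = (t - a) * (gradient f (x + c *\<^sub>R (y - x)) \<bullet> (y - x))"
      using MVT2[OF \<open>a < t\<close> der'] by blast
    have c01: "c \<in> {0..1}"
      using c a(1) t by (auto simp: T_def)
    have "0 < (t - a) * (gradient f (x + c *\<^sub>R (y - x)) \<bullet> (y - x))"
      using mvt above a(1) by (simp add: T_def)
    then have pos: "0 < gradient f (x + c *\<^sub>R (y - x)) \<bullet> (y - x)"
      using \<open>a < t\<close> by (simp add: zero_less_mult_iff)
    have "c \<notin> T"
      using a(2)[of c] c by auto
    then have "f y < f (x + c *\<^sub>R (y - x))"
      using c c01 le by (auto simp: T_def \<phi>_def)
    then have "gradient f (x + c *\<^sub>R (y - x)) \<bullet> (y - (x + c *\<^sub>R (y - x))) \<le> 0"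
      using grad inG[OF c01] xy by blast
    moreover have "y - (x + c *\<^sub>R (y - x)) = (1 - c) *\<^sub>R (y - x)"
      by (simp add: algebra_simps)
    ultimately have "(1 - c) * (gradient f (x + c *\<^sub>R (y - x)) \<bullet> (y - x)) \<le> 0"
      by simp
    then show False
      using pos c t by (auto simp: mult_le_0_iff)
  qed
  then show "f ((1 - t) *\<^sub>R x + t *\<^sub>R y) \<le> f x"
    by (simp add: \<phi>_def algebra_simps)
qed

section \<open>Gradients along a segment of constancy\<close>

text \<open>Moving \<open>x\<close> by \<open>s d\<close> with \<open>y\<close> fixed moves the intermediate point with parameter \<open>l\<close> by
  \<open>s (1 - l) d\<close>, so that quasiconvexity compares the difference quotients at the two points.\<close>

lemma gradient_halfspace_interior:
  fixes f :: "'a::euclidean_space \<Rightarrow> real"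
  assumes qc: "quasiconvex_on G f" and G: "open G" "x \<in> G" "y \<in> G"
    and l: "0 \<le> l" "l < 1"
    and diff: "f differentiable (at x)" "f differentiable (at (x + l *\<^sub>R (y - x)))"
    and eq: "f y = f x" "f (x + l *\<^sub>R (y - x)) = f x"
    and d: "gradient f x \<bullet> d \<le> 0"
  shows "gradient f (x + l *\<^sub>R (y - x)) \<bullet> d \<le> 0"
proof -
  define z where "z = x + l *\<^sub>R (y - x)"
  have "gradient f z \<bullet> ((1 - l) *\<^sub>R d) \<le> max (gradient f x \<bullet> d) 0"
  proof (rule tendsto_le[OF trivial_limit_at_right_real])
    show "((\<lambda>s. max ((f (x + s *\<^sub>R d) - f x) / s) 0) \<longlongrightarrow> max (gradient f x \<bullet> d) 0) (at_right 0)"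
      by (intro tendsto_max directional_quotient_tendsto diff tendsto_const)
    show "((\<lambda>s. (f (z + s *\<^sub>R ((1 - l) *\<^sub>R d)) - f z) / s) \<longlongrightarrow> gradient f z \<bullet> ((1 - l) *\<^sub>R d))
        (at_right 0)"
      using diff(2) unfolding z_def by (rule directional_quotient_tendsto)
    show "eventually (\<lambda>s. (f (z + s *\<^sub>R ((1 - l) *\<^sub>R d)) - f z) / s
        \<le> max ((f (x + s *\<^sub>R d) - f x) / s) 0) (at_right 0)"
      using eventually_line_in_open[OF G(1,2), of d] eventually_at_right_0_less_1
    proof eventually_elim
      case (elim s)
      have "z + s *\<^sub>R ((1 - l) *\<^sub>R d) = (x + s *\<^sub>R d) + l *\<^sub>R (y - (x + s *\<^sub>R d))"
        by (simp add: z_def algebra_simps)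
      then have "f (z + s *\<^sub>R ((1 - l) *\<^sub>R d)) \<le> max (f (x + s *\<^sub>R d)) (f y)"
        using quasiconvex_on_le_max[OF qc elim(1) G(3), of l] l by simp
      then have "f (z + s *\<^sub>R ((1 - l) *\<^sub>R d)) - f z \<le> max (f (x + s *\<^sub>R d) - f x) 0"
        using eq by (auto simp: z_def max_def)
      then have "(f (z + s *\<^sub>R ((1 - l) *\<^sub>R d)) - f z) / s \<le> max (f (x + s *\<^sub>R d) - f x) 0 / s"
        using elim(2) by (intro divide_right_mono) auto
      also have "\<dots> = max ((f (x + s *\<^sub>R d) - f x) / s) 0"
        using elim(2) by (auto simp: max_def divide_le_0_iff)
      finally show ?case .
    qed
  qed
  then have "(1 - l) * (gradient f z \<bullet> d) \<le> 0"
    using d by simp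
  then show ?thesis
    using l by (auto simp: mult_le_0_iff z_def)
qed

text \<open>The bound for interior points degenerates as \<open>l\<close> tends to \<open>1\<close>, the shift \<open>s (1 - l) d\<close>
  becoming zero; the end point \<open>y\<close> is reached by continuity of the gradient.\<close>

lemma gradient_halfspace_transfer:
  fixes f :: "'a::euclidean_space \<Rightarrow> real"
  assumes qc: "quasiconvex_on G f" and G: "open G" "convex G" "x \<in> G" "y \<in> G"
    and C1: "continuously_differentiable_on G f"
    and const: "\<And>l. 0 \<le> l \<Longrightarrow> l \<le> 1 \<Longrightarrow> f (x + l *\<^sub>R (y - x)) = f x"
    and d: "gradient f x \<bullet> d \<le> 0"
  shows "gradient f y \<bullet> d \<le> 0"
proof -
  have diff: "f differentiable (at z)" if "z \<in> G" for z
    using C1 that by (simp add: continuously_differentiable_on_def)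
  have "isCont (gradient f) y"
    using C1 G by (simp add: continuously_differentiable_on_def continuous_on_eq_continuous_at)
  moreover have "((\<lambda>l. x + l *\<^sub>R (y - x)) \<longlongrightarrow> x + 1 *\<^sub>R (y - x)) (at_left 1)"
    by (intro tendsto_intros)
  ultimately have "((\<lambda>l. gradient f (x + l *\<^sub>R (y - x))) \<longlongrightarrow> gradient f y) (at_left 1)"
    using isCont_tendsto_compose by fastforce
  then have lim: "((\<lambda>l. gradient f (x + l *\<^sub>R (y - x)) \<bullet> d) \<longlongrightarrow> gradient f y \<bullet> d) (at_left 1)"
    by (intro tendsto_intros)
  have bound: "gradient f (x + l *\<^sub>R (y - x)) \<bullet> d \<le> 0" if "l \<in> {0<..<1}" for l
  proof -
    have "(1 - l) *\<^sub>R x + l *\<^sub>R y \<in> G"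
      using that G by (intro convexD) auto
    then have "x + l *\<^sub>R (y - x) \<in> G"
      by (simp add: algebra_simps)
    then show ?thesis
      using that G d const[of 1] const[of l]
      by (intro gradient_halfspace_interior[OF qc]) (auto intro: diff)
  qed
  show ?thesis
    by (rule tendsto_upperbound[OF lim eventually_at_leftI[of 0 1]]) (auto intro: bound)
qed

text \<open>Single-inequality Farkas lemma.\<close>

lemma nonneg_multiple_of_halfspace_subset:
  fixes a b :: "'a::real_inner"
  assumes sub: "\<And>d. b \<bullet> d \<le> 0 \<Longrightarrow> a \<bullet> d \<le> 0"
  shows "\<exists>q\<ge>0. a = q *\<^sub>R b"
proof (cases "b = 0")
  case True
  then have "a \<bullet> a \<le> 0"
    using sub by simp
  then have "a \<bullet> a = 0"
    by (intro order_antisym) auto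
  then have "a = 0"
    by simp
  then show ?thesis
    by auto
next
  case False
  define q where "q = (a \<bullet> b) / (b \<bullet> b)"
  define d where "d = a - q *\<^sub>R b"
  have "b \<bullet> d = 0"
    using False by (simp add: d_def q_def inner_diff_right inner_commute)
  moreover from this have "a \<bullet> d = d \<bullet> d"
    by (simp add: d_def inner_diff_left)
  ultimately have "d \<bullet> d \<le> 0"
    using sub[of d] by simp
  then have "d \<bullet> d = 0"
    by (intro order_antisym) auto
  then have "a = q *\<^sub>R b"
    by (simp add: d_def)
  moreover have "0 \<le> a \<bullet> b"
    using sub[of "- b"] by simp
  ultimately show ?thesis
    unfolding q_def by (metis divide_nonneg_nonneg inner_ge_zero)
qed

lemma gradients_positively_proportional:
  fixes f :: "'a::euclidean_space \<Rightarrow> real"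
  assumes qc: "quasiconvex_on G f" and G: "open G" "convex G" "x \<in> G" "y \<in> G"
    and C1: "continuously_differentiable_on G f"
    and const: "\<And>l. 0 \<le> l \<Longrightarrow> l \<le> 1 \<Longrightarrow> f (x + l *\<^sub>R (y - x)) = f x"
  shows "\<exists>p>0. gradient f x = p *\<^sub>R gradient f y"
proof -
  have const': "f (y + l *\<^sub>R (x - y)) = f y" if "0 \<le> l" "l \<le> 1" for l
  proof -
    have "y + l *\<^sub>R (x - y) = x + (1 - l) *\<^sub>R (y - x)"
      by (simp add: algebra_simps)
    then show ?thesis
      using const[of "1 - l"] const[of 1] that by simp
  qed
  obtain q where q: "0 \<le> q" "gradient f y = q *\<^sub>R gradient f x"
    using nonneg_multiple_of_halfspace_subset gradient_halfspace_transfer[OF qc G C1 const] by metis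
  obtain p where p: "0 \<le> p" "gradient f x = p *\<^sub>R gradient f y"
    using nonneg_multiple_of_halfspace_subset
      gradient_halfspace_transfer[OF qc G(1,2,4,3) C1 const'] by metis
  show ?thesis
  proof (cases "p = 0")
    case True
    then have "gradient f x = 1 *\<^sub>R gradient f y"
      using p q by simp
    then show ?thesis
      using zero_less_one by blast
  next
    case False
    then have "0 < p"
      using p(1) by simp
    then show ?thesis
      using p(2) by blast
  qed
qed

section \<open>Second-order derivatives\<close>

lemma second_quot_tendsto_zero:
  assumes orth: "gradient f x \<bullet> u = 0"
    and const: "\<And>t. 0 < t \<Longrightarrow> t < 1 \<Longrightarrow> f (x + t *\<^sub>R u) = f x"
  shows "(second_quot f x u \<longlongrightarrow> 0) (at_right 0)"
proof (rule tendsto_eventually)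
  show "eventually (\<lambda>t. second_quot f x u t = 0) (at_right 0)"
    using eventually_at_right_0_less_1
    by eventually_elim (simp add: second_quot_def orth const)
qed

lemma second_lower_dini_nonneg:
  assumes orth: "gradient f x \<bullet> u = 0"
    and min: "\<And>t. 0 < t \<Longrightarrow> t < 1 \<Longrightarrow> f x \<le> f (x + t *\<^sub>R u)"
  shows "0 \<le> second_lower_dini f x u"
  unfolding second_lower_dini_def
proof (rule Liminf_bounded)
  show "eventually (\<lambda>t. 0 \<le> second_quot f x u t) (at_right 0)"
    using eventually_at_right_0_less_1
    by eventually_elim (use min in \<open>simp add: second_quot_def orth\<close>)
qed

section \<open>The solution set\<close>

lemma feasible_set_segment:
  assumes "X \<subseteq> G" "convex X" and qc: "\<forall>i. quasiconvex_on G (\<lambda>x. g x $ i)"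
    and xy: "x \<in> feasible_set X g" "y \<in> feasible_set X g" and t: "0 \<le> t" "t \<le> 1"
  shows "x + t *\<^sub>R (y - x) \<in> feasible_set X g"
proof -
  have "(1 - t) *\<^sub>R x + t *\<^sub>R y \<in> X"
    using xy t \<open>convex X\<close> by (intro convexD) (auto simp: feasible_set_def)
  then have "x + t *\<^sub>R (y - x) \<in> X"
    by (simp add: algebra_simps)
  moreover have "g (x + t *\<^sub>R (y - x)) $ i \<le> 0" for i
  proof -
    have "g (x + t *\<^sub>R (y - x)) $ i \<le> max (g x $ i) (g y $ i)"
      using qc xy t \<open>X \<subseteq> G\<close>
      by (intro quasiconvex_on_le_max[of G "\<lambda>x. g x $ i"]) (auto simp: feasible_set_def)
    also have "\<dots> \<le> 0"
      using xy by (simp add: feasible_set_def)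
    finally show ?thesis .
  qed
  ultimately show ?thesis
    by (simp add: feasible_set_def)
qed

text \<open>Constraints with positive multiplier stay active: in the KKT inequality every summand is
  nonpositive along \<open>x - xb\<close>, hence zero, while a gradient orthogonal to \<open>x - xb\<close>, being nonzero
  by GMFCQ, is incompatible with \<open>g\<^sub>i(x) < 0\<close>.\<close>

lemma mem_X1_of_orthogonal:
  fixes g :: "'a::euclidean_space \<Rightarrow> real^'m"
  assumes G: "open G" "X \<subseteq> G" "xb \<in> X" "x \<in> feasible_set X g"
    and diff: "\<forall>x\<in>G. g differentiable (at x)"
    and qc: "\<forall>i. quasiconvex_on G (\<lambda>x. g x $ i)"
    and gmf: "GMFCQ X g xb" and kkt: "KKT f X g xb \<mu>"
    and orth: "gradient f xb \<bullet> (x - xb) = 0"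
  shows "x \<in> X1 X g xb \<mu>"
proof -
  have x: "x \<in> X" "x \<in> G" and xb: "xb \<in> G" and feas: "\<And>i. g x $ i \<le> 0"
    using G by (auto simp: feasible_set_def)
  have diffi: "(\<lambda>z. g z $ i) differentiable (at z)" if "z \<in> G" for z i
    using diff that bounded_linear.has_derivative[OF bounded_linear_vec_nth]
    unfolding differentiable_def by blast
  let ?T = "\<lambda>i. \<mu> $ i * (gradient (\<lambda>z. g z $ i) xb \<bullet> (x - xb))"
  have nonpos: "?T i \<le> 0" if "i \<in> active_set g xb" for i
  proof -
    have "gradient (\<lambda>z. g z $ i) xb \<bullet> (x - xb) \<le> 0"
      using qc x xb feas that
      by (intro gradient_inner_nonpos_of_quasiconvex[of G] diffi) (auto simp: active_set_def)
    then show ?thesis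
      using kkt by (simp add: KKT_def mult_nonneg_nonpos)
  qed
  have "0 \<le> (gradient f xb + (\<Sum>i\<in>active_set g xb. \<mu> $ i *\<^sub>R gradient (\<lambda>z. g z $ i) xb)) \<bullet> (x - xb)"
    using kkt x by (simp add: KKT_def)
  then have "0 \<le> (\<Sum>i\<in>active_set g xb. ?T i)"
    using orth by (simp add: inner_add_left inner_sum_left)
  then have "(\<Sum>i\<in>active_set g xb. - ?T i) = 0"
    using nonpos by (simp add: sum_negf sum_nonpos order_antisym)
  then have zero: "?T i = 0" if "i \<in> active_set g xb" for i
    using that nonpos sum_nonneg_eq_0_iff[of "active_set g xb" "\<lambda>i. - ?T i"] by auto
  have "g x $ i = 0" if i: "i \<in> strict_active_set g xb \<mu>" for i
  proof (rule ccontr)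
    assume "g x $ i \<noteq> 0"
    then have "g x $ i < g xb $ i"
      using feas[of i] i by (simp add: strict_active_set_def)
    moreover have act: "i \<in> active_set g xb"
      using i by (simp add: active_set_def strict_active_set_def)
    moreover have "gradient (\<lambda>z. g z $ i) xb \<bullet> (x - xb) = 0"
      using zero[OF act] i by (simp add: strict_active_set_def)
    ultimately have "gradient (\<lambda>z. g z $ i) xb = 0"
      using qc G x xb diffi by (intro gradient_zero_of_lower_orthogonal[of G _ xb x]) auto
    then show False
      using gmf act by (auto simp: GMFCQ_def)
  qed
  then show ?thesis
    using x feas by (simp add: X1_def)
qed

lemma solution_set_subset_S5:
  fixes f :: "'a::euclidean_space \<Rightarrow> real" and g :: "'a \<Rightarrow> real^'m"
  assumes G: "open G" "convex G" "X \<subseteq> G" "convex X"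
    and C1: "continuously_differentiable_on G f" and qf: "quasiconvex_on G f"
    and diff: "\<forall>x\<in>G. g differentiable (at x)"
    and qc: "\<forall>i. quasiconvex_on G (\<lambda>x. g x $ i)"
    and xb: "xb \<in> solution_set f X g"
    and gmf: "GMFCQ X g xb" and kkt: "KKT f X g xb \<mu>"
  shows "solution_set f X g \<subseteq> S5 f X g xb \<mu>"
proof
  fix x
  assume x: "x \<in> solution_set f X g"
  have feas: "x \<in> feasible_set X g" "xb \<in> feasible_set X g"
    using x xb by (auto simp: solution_set_def)
  then have inG: "x \<in> G" "xb \<in> G"
    using G by (auto simp: feasible_set_def)
  have fd: "f differentiable (at x)" "f differentiable (at xb)"
    using C1 inG by (auto simp: continuously_differentiable_on_def)
  have eq: "f x = f xb"
    using x xb feas by (auto simp: solution_set_def intro: order_antisym)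
  have const: "f (x + t *\<^sub>R (xb - x)) = f x" if "0 \<le> t" "t \<le> 1" for t
  proof (rule order_antisym)
    show "f (x + t *\<^sub>R (xb - x)) \<le> f x"
      using quasiconvex_onD[OF qf inG that] eq by simp
    show "f x \<le> f (x + t *\<^sub>R (xb - x))"
      using x feasible_set_segment[OF G(3,4) qc feas that] by (simp add: solution_set_def)
  qed
  have const': "f (xb + t *\<^sub>R (x - xb)) = f xb" if "0 \<le> t" "t \<le> 1" for t
  proof -
    have "xb + t *\<^sub>R (x - xb) = x + (1 - t) *\<^sub>R (xb - x)"
      by (simp add: algebra_simps)
    then show ?thesis
      using const[of "1 - t"] that eq by simp
  qed
  have orth_of_const: "gradient f a \<bullet> u = 0"
    if "f differentiable (at a)" and "\<And>t. 0 \<le> t \<Longrightarrow> t \<le> 1 \<Longrightarrow> f (a + t *\<^sub>R u) = f a" for a u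
  proof (rule tendsto_unique[OF trivial_limit_at_right_real])
    show "((\<lambda>s. (f (a + s *\<^sub>R u) - f a) / s) \<longlongrightarrow> gradient f a \<bullet> u) (at_right 0)"
      using that(1) by (rule directional_quotient_tendsto)
    show "((\<lambda>s. (f (a + s *\<^sub>R u) - f a) / s) \<longlongrightarrow> 0) (at_right 0)"
      using eventually_at_right_0_less_1
      by (intro tendsto_eventually, eventually_elim) (simp add: that(2))
  qed
  have orth: "gradient f x \<bullet> (xb - x) = 0" "gradient f xb \<bullet> (x - xb) = 0"
    using orth_of_const fd const const' by auto
  have "x \<in> X1 X g xb \<mu>"
    using feas orth(2) by (intro mem_X1_of_orthogonal[OF G(1,3) _ _ diff qc gmf kkt])
      (auto simp: feasible_set_def)
  moreover have "\<exists>p>0. gradient f x = p *\<^sub>R gradient f xb"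
    using gradients_positively_proportional[OF qf G(1,2) inG C1 const] by simp
  moreover have lim: "(second_quot f x (xb - x) \<longlongrightarrow> 0) (at_right 0)"
    using orth(1) const by (intro second_quot_tendsto_zero) auto
  moreover have "second_deriv f x (xb - x) = 0"
    unfolding second_deriv_def using lim by (intro tendsto_Lim) auto
  moreover have "(second_quot f xb (x - xb) \<longlongrightarrow> 0) (at_right 0)"
    using orth(2) const' by (intro second_quot_tendsto_zero) auto
  then have "second_lower_dini f xb (x - xb) = 0"
    unfolding second_lower_dini_def by (intro lim_imp_Liminf) auto
  ultimately show "x \<in> S5 f X g xb \<mu>"
    using orth(2) by (auto simp: S5_def second_deriv_exists_def)
qed

lemma X1_subset_feasible_set: "X1 X g xb \<mu> \<subseteq> feasible_set X g"
proof
  fix x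
  assume x: "x \<in> X1 X g xb \<mu>"
  have "g x $ i \<le> 0" for i
    using x by (cases "i \<in> strict_active_set g xb \<mu>") (auto simp: X1_def)
  then show "x \<in> feasible_set X g"
    using x by (auto simp: X1_def feasible_set_def)
qed

text \<open>Proportionality of the gradients turns the first-order inequality at \<open>x\<close> into one at \<open>xb\<close>,
  opposite to the assumed one.\<close>

lemma nonsolution_second_deriv_negative:
  assumes "xb \<in> G" "x \<in> G" and pc: "second_order_pseudoconvex_on G f"
    and less: "f xb < f x" and le: "gradient f xb \<bullet> (x - xb) \<le> 0"
    and proportional: "\<exists>p>0. gradient f x = p *\<^sub>R gradient f xb"
  shows "gradient f xb \<bullet> (x - xb) = 0" and "second_deriv f x (xb - x) < 0"
proof -
  obtain p where p: "0 < p" "gradient f x = p *\<^sub>R gradient f xb"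
    using proportional by blast
  have rev: "gradient f x \<bullet> (xb - x) = - (p * (gradient f xb \<bullet> (x - xb)))"
    by (simp add: p inner_diff_right algebra_simps)
  have "gradient f x \<bullet> (xb - x) \<le> 0"
    using assms by (auto simp: second_order_pseudoconvex_on_def)
  then show orth: "gradient f xb \<bullet> (x - xb) = 0"
    using rev p(1) le by (simp add: zero_le_mult_iff)
  show "second_deriv f x (xb - x) < 0"
    using pc assms(1,2) less rev orth by (auto simp: second_order_pseudoconvex_on_def)
qed

lemma mem_solution_set_of_le:
  assumes "xb \<in> solution_set f X g" "x \<in> feasible_set X g" "\<not> f xb < f x"
  shows "x \<in> solution_set f X g"
  using assms by (force simp: solution_set_def)

lemma S2_subset_solution_set:
  assumes "X \<subseteq> G" and pc: "second_order_pseudoconvex_on G f"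
    and xb: "xb \<in> solution_set f X g"
  shows "S2 f X g xb \<mu> \<subseteq> solution_set f X g"
proof
  fix x
  assume x: "x \<in> S2 f X g xb \<mu>"
  then have "x \<in> X1 X g xb \<mu>"
    by (simp add: S2_def)
  then have feas: "x \<in> feasible_set X g"
    by (rule subsetD[OF X1_subset_feasible_set])
  then have inG: "x \<in> G" "xb \<in> G"
    using xb \<open>X \<subseteq> G\<close> by (auto simp: solution_set_def feasible_set_def)
  have "\<not> f xb < f x"
  proof
    assume "f xb < f x"
    then have "second_deriv f x (xb - x) < 0"
      using x by (intro nonsolution_second_deriv_negative(2)[OF inG(2,1) pc]) (auto simp: S2_def)
    then show False
      using x by (simp add: S2_def not_less[symmetric])
  qed
  then show "x \<in> solution_set f X g"
    by (rule mem_solution_set_of_le[OF xb feas])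
qed

lemma S4_subset_solution_set:
  assumes X: "X \<subseteq> G" "convex X" and pc: "second_order_pseudoconvex_on G f"
    and qc: "\<forall>i. quasiconvex_on G (\<lambda>x. g x $ i)"
    and xb: "xb \<in> solution_set f X g"
  shows "S4 f X g xb \<mu> \<subseteq> solution_set f X g"
proof
  fix x
  assume x: "x \<in> S4 f X g xb \<mu>"
  then have "x \<in> X1 X g xb \<mu>"
    by (simp add: S4_def)
  then have feas: "x \<in> feasible_set X g"
    by (rule subsetD[OF X1_subset_feasible_set])
  have feasb: "xb \<in> feasible_set X g"
    using xb by (simp add: solution_set_def)
  have inG: "x \<in> G" "xb \<in> G"
    using feas feasb \<open>X \<subseteq> G\<close> by (auto simp: feasible_set_def)
  have "\<not> f xb < f x"
  proof
    assume "f xb < f x"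
    moreover have "gradient f xb \<bullet> (x - xb) \<le> 0" "\<exists>p>0. gradient f x = p *\<^sub>R gradient f xb"
      using x by (auto simp: S4_def)
    ultimately have orth: "gradient f xb \<bullet> (x - xb) = 0" and neg: "second_deriv f x (xb - x) < 0"
      by (rule nonsolution_second_deriv_negative[OF inG(2,1) pc])+
    have "0 \<le> second_lower_dini f xb (x - xb)"
      using feasible_set_segment[OF X qc feasb feas] xb
      by (intro second_lower_dini_nonneg orth) (simp add: solution_set_def)
    also have "\<dots> \<le> second_deriv f x (xb - x)"
      using x by (simp add: S4_def)
    finally show False
      using neg by simp
  qed
  then show "x \<in> solution_set f X g"
    by (rule mem_solution_set_of_le[OF xb feas])
qed

theorem theorem2:
  fixes \<Gamma> X :: "(real^'s) set"
    and f :: "real^'s \<Rightarrow> real"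
    and g :: "real^'s \<Rightarrow> real^'m"
    and xb :: "real^'s"
    and \<mu> :: "real^'m"
  assumes "open \<Gamma>" and "convex \<Gamma>"
    and "X \<subseteq> \<Gamma>" and "convex X"
    and "continuously_differentiable_on \<Gamma> f"
    and "second_order_pseudoconvex_on \<Gamma> f"
    and "\<forall>x\<in>\<Gamma>. g differentiable (at x)"
    and "\<forall>i. quasiconvex_on \<Gamma> (\<lambda>x. g x $ i)"
    and "xb \<in> solution_set f X g"
    and "GMFCQ X g xb"
    and "KKT f X g xb \<mu>"
  shows "solution_set f X g = S1 f X g xb \<mu> \<and>
         S1 f X g xb \<mu> = S2 f X g xb \<mu> \<and>
         S2 f X g xb \<mu> = S3 f X g xb \<mu> \<and>
         S3 f X g xb \<mu> = S4 f X g xb \<mu> \<and>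
         S4 f X g xb \<mu> = S5 f X g xb \<mu>"
proof -
  have "quasiconvex_on \<Gamma> f"
    using assms(2,6)
    by (intro quasiconvex_on_of_gradient_condition) (auto simp: second_order_pseudoconvex_on_def)
  then have sol5: "solution_set f X g \<subseteq> S5 f X g xb \<mu>"
    using assms by (intro solution_set_subset_S5) auto
  have sol2: "S2 f X g xb \<mu> \<subseteq> solution_set f X g"
    using assms by (intro S2_subset_solution_set) auto
  have sol4: "S4 f X g xb \<mu> \<subseteq> solution_set f X g"
    using assms by (intro S4_subset_solution_set) auto
  have "S5 f X g xb \<mu> \<subseteq> S1 f X g xb \<mu>" "S1 f X g xb \<mu> \<subseteq> S2 f X g xb \<mu>"
    "S5 f X g xb \<mu> \<subseteq> S3 f X g xb \<mu>" "S3 f X g xb \<mu> \<subseteq> S4 f X g xb \<mu>"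
    by (auto simp: S1_def S2_def S3_def S4_def S5_def)
  then show ?thesis
    using sol5 sol2 sol4 by blast
qed

end
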